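(* There is an absolute constant $c_0>0$ such that for every $k\in\mathbb{N}$ there is an undirected quasi-bipartite graph $G$ with $k$ terminals such that every vertex-cut sparsifier of $G$ that is a subgraph of $G$ has at least $c_0 k^2$ vertices.
   Context: Graphs are unweighted and undirected. For vertex sets $A,B\subseteq V$ of $G=(V,E)$, an $(A,B)$-vertex-cut is a set $C\subseteq V$ (which may intersect $A\cup B$) such that for all $a\in A\setminus C$ and $b\in B\setminus C$ there is no path from $a$ to $b$ in $G\setminus C$; $\mathrm{mincut}_G(A,B)$ is the minimum size of an $(A,B)$-vertex-cut. A vertex-cut sparsifier of $G$ with respect to terminals $T\subseteq V$ is a graph $G'=(V',E')$ with $T\subseteq V'$ such that $\mathrm{mincut}_G(A,B)=\mathrm{mincut}_{G'}(A,B)$ for all $A,B\subseteq T$. A graph with terminal set $T$ is quasi-bipartite if every edge has at least one endpoint in $T$. *)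

theory Defs
  imports Complex_Main "Graph_Theory.Graph_Theory"
begin

text \<open>
  An undirected graph is represented, as usual with Graph_Theory, by a finite symmetric digraph
  without loops and parallel arcs (locales \<open>graph\<close> and \<open>pair_graph\<close>); an undirected edge
  \<open>uv\<close> is the pair of opposite arcs \<open>(u,v)\<close>, \<open>(v,u)\<close>.
\<close>

text \<open>
  A path may consist of a single vertex, so every cut contains \<open>A \<inter> B\<close>.
\<close>

definition is_vertex_cut :: "('a,'b) pre_digraph \<Rightarrow> 'a set \<Rightarrow> 'a set \<Rightarrow> 'a set \<Rightarrow> bool" where
  "is_vertex_cut G A B C \<longleftrightarrow>
     C \<subseteq> verts G \<and>
     (\<forall>a \<in> A - C. \<forall>b \<in> B - C. \<not> (\<exists>p. pre_digraph.apath (G \<restriction> (verts G - C)) a p b))"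

text \<open>
  For a finite graph and \<open>A \<subseteq> verts G\<close> this is the minimum of a finite set which is nonempty,
  as \<open>A\<close> itself is a cut.
\<close>

definition mincut :: "('a,'b) pre_digraph \<Rightarrow> 'a set \<Rightarrow> 'a set \<Rightarrow> nat" where
  "mincut G A B = Min {card C | C. is_vertex_cut G A B C}"

definition vertex_cut_sparsifier ::
  "('a,'b) pre_digraph \<Rightarrow> 'a set \<Rightarrow> ('a,'c) pre_digraph \<Rightarrow> bool" where
  "vertex_cut_sparsifier G T H \<longleftrightarrow>
     graph H \<and> T \<subseteq> verts H \<and> (\<forall>A B. A \<subseteq> T \<and> B \<subseteq> T \<longrightarrow> mincut G A B = mincut H A B)"

definition quasi_bipartite :: "('a,'b) pre_digraph \<Rightarrow> 'a set \<Rightarrow> bool" where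
  "quasi_bipartite G T \<longleftrightarrow> (\<forall>e \<in> arcs G. tail G e \<in> T \<or> head G e \<in> T)"

end

theory Submission
  imports Defs "HOL-Library.Nat_Bijection"
begin

text \<open>
  Take the subdivision of the complete graph on \<open>k\<close> terminals. For terminals \<open>i \<noteq> j\<close>, let
  \<open>A = T - {j}\<close> and \<open>B = T - {i}\<close>. Every cut contains \<open>A \<inter> B = T - {i, j}\<close>, and the only path from
  \<open>i\<close> to \<open>j\<close> avoiding these terminals runs through the vertex subdividing the edge \<open>ij\<close>. Hence
  removing that vertex decreases the minimum cut from \<open>k - 1\<close> to \<open>k - 2\<close>, so a subgraph that is a
  sparsifier keeps all \<open>k (k - 1) / 2\<close> subdividing vertices.
\<close>

section \<open>Walks and minimum vertex cuts in arbitrary graphs\<close>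

text \<open>Induction along the walk. This turns non-reachability into exhibiting a set that is
  closed under arcs, contains the start and misses the target.\<close>

lemma cas_closed:
  assumes "pre_digraph.cas G a p b" "set p \<subseteq> arcs G" "a \<in> S"
    and "\<And>e. e \<in> arcs G \<Longrightarrow> tail G e \<in> S \<Longrightarrow> head G e \<in> S"
  shows "b \<in> S"
  using assms(1-3)
  by (induction p arbitrary: a) (auto simp: pre_digraph.cas.simps assms(4))

lemma finite_cut_cards:
  assumes "finite (verts G)"
  shows "finite {card C | C. is_vertex_cut G A B C}"
proof (rule finite_subset)
  show "{card C | C. is_vertex_cut G A B C} \<subseteq> card ` Pow (verts G)"
    by (auto simp: is_vertex_cut_def)
qed (use assms in simp)

lemma mincut_le:
  assumes "finite (verts G)" "is_vertex_cut G A B C"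
  shows "mincut G A B \<le> card C"
  unfolding mincut_def using assms by (intro Min_le finite_cut_cards) auto

text \<open>\<open>A\<close> is itself a cut because \<open>A \<subseteq> verts G\<close>, so the
  minimum ranges over a nonempty finite set and a bound on every cut carries over to it.\<close>

lemma mincut_ge:
  assumes "finite (verts G)" "A \<subseteq> verts G"
    and "\<And>C. is_vertex_cut G A B C \<Longrightarrow> n \<le> card C"
  shows "n \<le> mincut G A B"
proof -
  have "is_vertex_cut G A B A"
    using assms(2) by (simp add: is_vertex_cut_def)
  then have "{card C | C. is_vertex_cut G A B C} \<noteq> {}"
    by blast
  then show ?thesis
    unfolding mincut_def using assms(1,3) by (subst Min_ge_iff) (auto intro: finite_cut_cards)
qed

text \<open>The empty arc list is a path from a vertex to itself, so a common vertex of
  \<open>A\<close> and \<open>B\<close> can only be separated by being deleted.\<close>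

lemma vertex_cut_inter:
  assumes "is_vertex_cut G A B C" "A \<subseteq> verts G"
  shows "A \<inter> B \<subseteq> C"
proof
  fix x assume x: "x \<in> A \<inter> B"
  show "x \<in> C"
  proof (rule ccontr)
    assume "x \<notin> C"
    with x assms(2) have "pre_digraph.apath (G \<restriction> (verts G - C)) x [] x"
      by (auto simp: pre_digraph.apath_def pre_digraph.awalk_def pre_digraph.cas.simps
          pre_digraph.awalk_verts.simps)
    with x \<open>x \<notin> C\<close> assms(1) show False
      unfolding is_vertex_cut_def by blast
  qed
qed

section \<open>The subdivided complete graph\<close>

text \<open>\<open>set_encode\<close> is injective on finite sets, so distinct edges get distinct
  names; the shift by \<open>k\<close> keeps these names apart from the terminals
  \<open>{..<k}\<close>.\<close>

definition edge_vertex :: "nat \<Rightarrow> nat set \<Rightarrow> nat" where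
  "edge_vertex k e = k + set_encode e"

definition complete_edges :: "nat \<Rightarrow> nat set set" where
  "complete_edges k = {e. e \<subseteq> {..<k} \<and> card e = 2}"

definition subdivided_complete :: "nat \<Rightarrow> nat pair_pre_digraph" where
  "subdivided_complete k =
     \<lparr> pverts = {..<k} \<union> edge_vertex k ` complete_edges k,
       parcs = {(i, edge_vertex k e) | i e. e \<in> complete_edges k \<and> i \<in> e} \<union>
               {(edge_vertex k e, i) | i e. e \<in> complete_edges k \<and> i \<in> e} \<rparr>"

lemma finite_complete_edges: "finite (complete_edges k)"
  by (rule finite_subset[of _ "Pow {..<k}"]) (auto simp: complete_edges_def)

lemma inj_on_edge_vertex: "inj_on (edge_vertex k) (complete_edges k)"
proof (rule inj_onI)
  fix e f assume "e \<in> complete_edges k" "f \<in> complete_edges k" "edge_vertex k e = edge_vertex k f"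
  then show "e = f"
    by (auto simp: edge_vertex_def complete_edges_def set_encode_eq finite_subset)
qed

lemma edge_vertex_not_less [simp]: "\<not> edge_vertex k e < k"
  by (simp add: edge_vertex_def)

lemma edge_vertex_neq: "i < k \<Longrightarrow> edge_vertex k e \<noteq> i"
  by (simp add: edge_vertex_def)

lemma complete_edges_less: "e \<in> complete_edges k \<Longrightarrow> i \<in> e \<Longrightarrow> i < k"
  by (auto simp: complete_edges_def)

lemma complete_edge_eq:
  assumes "e \<in> complete_edges k" "i \<in> e" "j \<in> e" "i \<noteq> j"
  shows "e = {i, j}"
  using assms by (auto simp: complete_edges_def card_2_iff)

lemma finite_pverts_subdivided_complete: "finite (pverts (subdivided_complete k))"
  by (simp add: subdivided_complete_def finite_complete_edges)

lemma terminals_subset_subdivided_complete: "{..<k} \<subseteq> pverts (subdivided_complete k)"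
  by (simp add: subdivided_complete_def)

lemma pair_graph_subdivided_complete: "pair_graph (subdivided_complete k)"
proof
  let ?G = "subdivided_complete k"
  show wf: "fst a \<in> pverts ?G" "snd a \<in> pverts ?G" if "a \<in> parcs ?G" for a
    using that by (auto simp: subdivided_complete_def dest: complete_edges_less)
  show "finite (pverts ?G)"
    by (rule finite_pverts_subdivided_complete)
  have "parcs ?G \<subseteq> pverts ?G \<times> pverts ?G"
    using wf by fastforce
  then show "finite (parcs ?G)"
    by (rule finite_subset) (simp add: finite_pverts_subdivided_complete)
  show "fst a \<noteq> snd a" if "a \<in> parcs ?G" for a
    using that edge_vertex_neq[OF complete_edges_less]
    by (fastforce simp: subdivided_complete_def)
  show "symmetric (with_proj ?G)"
    unfolding symmetric_def
    by (rule symI) (auto simp: arcs_ends_def arc_to_ends_def subdivided_complete_def image_iff)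
qed

lemma quasi_bipartite_subdivided_complete: "quasi_bipartite (with_proj (subdivided_complete k)) {..<k}"
  by (auto simp: quasi_bipartite_def subdivided_complete_def dest: complete_edges_less)

section \<open>Cuts with and without a subdividing vertex\<close>

text \<open>The \<open>k - 2\<close> common terminals are forced into the cut, and the path through
  the vertex subdividing \<open>ij\<close> avoids them all, so hitting it costs one vertex
  more.\<close>

lemma cut_subdivided_complete_card:
  assumes "i < k" "j < k" "i \<noteq> j"
    and cut: "is_vertex_cut (with_proj (subdivided_complete k)) ({..<k} - {j}) ({..<k} - {i}) C"
  shows "k - 1 \<le> card C"
proof -
  let ?G = "with_proj (subdivided_complete k)"
  let ?v = "edge_vertex k {i, j}"
  have e: "{i, j} \<in> complete_edges k"
    using assms by (simp add: complete_edges_def)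
  have C: "C \<subseteq> verts ?G" "{..<k} - {i, j} \<subseteq> C"
    using cut vertex_cut_inter[OF cut]
    by (auto simp: is_vertex_cut_def subdivided_complete_def)
  have finC: "finite C"
    using C(1) finite_pverts_subdivided_complete finite_subset by fastforce
  have v: "?v \<noteq> i" "i \<noteq> ?v" "?v \<noteq> j" "j \<noteq> ?v"
    using assms edge_vertex_neq by metis+
  have "\<exists>x \<in> C. x \<in> {i, j, ?v}"
  proof (rule ccontr)
    assume "\<not> ?thesis"
    then have nC: "i \<notin> C" "j \<notin> C" "?v \<notin> C"
      by auto
    have "pre_digraph.apath (?G \<restriction> (verts ?G - C)) i [(i, ?v), (?v, j)] j"
      using assms nC e v
      by (auto simp: pre_digraph.apath_def pre_digraph.awalk_def pre_digraph.cas.simps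
          pre_digraph.awalk_verts.simps subdivided_complete_def induce_subgraph_def)
    with cut assms nC show False
      unfolding is_vertex_cut_def by blast
  qed
  then obtain x where x: "x \<in> C" "x \<in> {i, j, ?v}"
    by blast
  then have "x \<notin> {..<k} - {i, j}"
    by auto
  then have "card (insert x ({..<k} - {i, j})) = Suc (k - 2)"
    using assms by (simp add: card_Diff_subset)
  moreover have "card (insert x ({..<k} - {i, j})) \<le> card C"
    using C(2) x(1) finC by (intro card_mono) auto
  ultimately show ?thesis
    by linarith
qed

text \<open>Once the other terminals are deleted, the subdividing vertices adjacent to
  \<open>i\<close> are dead ends, except the one for \<open>ij\<close>, which is absent from
  \<open>H\<close>.\<close>

lemma cut_without_edge_vertex:
  fixes H :: "nat pair_pre_digraph"
  assumes "i < k" "j < k" "i \<noteq> j"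
    and sub: "subgraph (with_proj H) (with_proj (subdivided_complete k))"
    and T: "{..<k} \<subseteq> pverts H" and v: "edge_vertex k {i, j} \<notin> pverts H"
  shows "is_vertex_cut (with_proj H) ({..<k} - {j}) ({..<k} - {i}) ({..<k} - {i, j})"
proof -
  let ?C = "{..<k} - {i, j}"
  let ?K = "with_proj H \<restriction> (verts (with_proj H) - ?C)"
  \<comment> \<open>\<open>S\<close> contains everything reachable from \<open>i\<close> in
    \<open>?K\<close>. It may include vertices outside \<open>H\<close>, since only closure under
    the arcs of \<open>?K\<close> and \<open>j \<notin> S\<close> matter.\<close>
  define S where "S = insert i {edge_vertex k e | e. e \<in> complete_edges k \<and> i \<in> e \<and> e \<noteq> {i, j}}"
  have closed: "head ?K a \<in> S" if a: "a \<in> arcs ?K" "tail ?K a \<in> S" for a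
  proof -
    obtain x y where xy: "a = (x, y)"
      by (cases a)
    have H: "(x, y) \<in> parcs (subdivided_complete k)" "x \<in> pverts H" "y \<in> pverts H"
      "x \<notin> ?C" "y \<notin> ?C" "x \<in> S"
      using a sub xy by (auto simp: subgraph_def induce_subgraph_def)
    consider e where "e \<in> complete_edges k" "x \<in> e" "y = edge_vertex k e"
      | e where "e \<in> complete_edges k" "y \<in> e" "x = edge_vertex k e"
      using H(1) by (auto simp: subdivided_complete_def)
    then have "y \<in> S"
    proof cases
      case 1
      then have "x = i"
        using H(6) complete_edges_less[OF 1(1,2)] edge_vertex_neq by (auto simp: S_def)
      with 1 H(3) v show ?thesis
        by (auto simp: S_def)
    next
      case 2
      then have "i \<in> e" "e \<noteq> {i, j}"
        using H(6) inj_onD[OF inj_on_edge_vertex] \<open>i < k\<close> edge_vertex_neq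
        by (fastforce simp: S_def)+
      \<comment> \<open>All other terminals are deleted. The case \<open>y = j\<close> would force
        \<open>e = {i, j}\<close>, so the arc can only lead back to \<open>i\<close>.\<close>
      moreover have "y \<in> {i, j}"
        using H(5) complete_edges_less[OF 2(1,2)] by auto
      ultimately have "y = i"
        using complete_edge_eq[OF 2(1)] 2(2) \<open>i \<noteq> j\<close> by auto
      then show ?thesis
        by (simp add: S_def)
    qed
    then show ?thesis
      by (simp add: xy)
  qed
  \<comment> \<open>Outside \<open>?C\<close> the two terminal sets shrink to \<open>{i}\<close> and
    \<open>{j}\<close>, so this is the only pair to separate.\<close>
  have "\<not> pre_digraph.apath ?K i p j" for p
  proof
    assume "pre_digraph.apath ?K i p j"
    then have "j \<in> S"
      using cas_closed[of ?K i p j S] closed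
      by (auto simp: pre_digraph.apath_def pre_digraph.awalk_def S_def)
    with assms(2,3) edge_vertex_neq show False
      by (auto simp: S_def)
  qed
  then show ?thesis
    using T by (auto simp: is_vertex_cut_def)
qed

text \<open>Each edge has its own pair of terminal sets whose minimum cut detects the loss of its
  subdividing vertex.\<close>

lemma sparsifier_contains_edge_vertex:
  fixes H :: "nat pair_pre_digraph"
  assumes sub: "subgraph (with_proj H) (with_proj (subdivided_complete k))"
    and spars: "vertex_cut_sparsifier (with_proj (subdivided_complete k)) {..<k} (with_proj H)"
    and e: "e \<in> complete_edges k"
  shows "edge_vertex k e \<in> pverts H"
proof (rule ccontr)
  assume v: "edge_vertex k e \<notin> pverts H"
  obtain i j where ij: "e = {i, j}" "i \<noteq> j" "i < k" "j < k"
    using e by (auto simp: complete_edges_def card_2_iff)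
  let ?G = "with_proj (subdivided_complete k)"
  let ?A = "{..<k} - {j}" and ?B = "{..<k} - {i}"
  have T: "{..<k} \<subseteq> pverts H"
    using spars by (simp add: vertex_cut_sparsifier_def)
  have "pverts H \<subseteq> pverts (subdivided_complete k)"
    using sub by (auto simp: subgraph_def)
  then have "finite (verts (with_proj H))"
    using finite_pverts_subdivided_complete finite_subset by fastforce
  then have "mincut (with_proj H) ?A ?B \<le> card ({..<k} - {i, j})"
    by (rule mincut_le[OF _ cut_without_edge_vertex[OF ij(3,4,2) sub T v[unfolded ij(1)]]])
  also have "\<dots> = k - 2"
    using ij by (simp add: card_Diff_subset)
  \<comment> \<open>Strict despite truncated subtraction: two distinct terminals give
    \<open>k \<ge> 2\<close>.\<close>
  also have "\<dots> < k - 1"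
    using ij by linarith
  also have "k - 1 \<le> mincut ?G ?A ?B"
    by (rule mincut_ge[OF _ _ cut_subdivided_complete_card[OF ij(3,4,2)]])
      (auto simp: finite_pverts_subdivided_complete, simp add: subdivided_complete_def)
  also have "\<dots> = mincut (with_proj H) ?A ?B"
    using spars by (simp add: vertex_cut_sparsifier_def Diff_subset)
  finally show False
    by simp
qed

text \<open>Terminals and subdividing vertices together number
  \<open>k + k (k - 1) / 2 = k (k + 1) / 2\<close>. Counting the terminals as well makes the
  constant \<open>1/2\<close> work for every \<open>k\<close>, small values included.\<close>

lemma sparsifier_card_ge:
  fixes H :: "nat pair_pre_digraph"
  assumes sub: "subgraph (with_proj H) (with_proj (subdivided_complete k))"
    and spars: "vertex_cut_sparsifier (with_proj (subdivided_complete k)) {..<k} (with_proj H)"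
  shows "real (card (pverts H)) \<ge> 1/2 * (real k)\<^sup>2"
proof -
  have "pverts H \<subseteq> pverts (subdivided_complete k)"
    using sub by (auto simp: subgraph_def)
  then have fin: "finite (pverts H)"
    using finite_pverts_subdivided_complete finite_subset by blast
  have "card ({..<k} \<union> edge_vertex k ` complete_edges k) = k + card (edge_vertex k ` complete_edges k)"
    by (subst card_Un_disjoint) (auto simp: finite_complete_edges edge_vertex_neq)
  also have "card (edge_vertex k ` complete_edges k) = k choose 2"
    using n_subsets[of "{..<k}" 2] by (simp add: card_image[OF inj_on_edge_vertex] flip: complete_edges_def)
  finally have "k + (k choose 2) = card ({..<k} \<union> edge_vertex k ` complete_edges k)"
    by simp
  also have "\<dots> \<le> card (pverts H)"
    using spars sparsifier_contains_edge_vertex[OF sub spars] fin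
    by (intro card_mono) (auto simp: vertex_cut_sparsifier_def)
  finally have "real k + real (k choose 2) \<le> real (card (pverts H))"
    by linarith
  moreover have "real (k choose 2) = real k * (real k - 1) / 2"
    by (simp add: binomial_gbinomial gbinomial_prod_rev numeral_2_eq_2)
  ultimately show ?thesis
    by (simp add: power2_eq_square field_simps)
qed

theorem theorem1p4:
  shows "\<exists>c0::real. c0 > 0 \<and>
    (\<forall>k::nat. \<exists>(G :: nat pair_pre_digraph) (T :: nat set).
       pair_graph G \<and> T \<subseteq> pverts G \<and> card T = k \<and> quasi_bipartite (with_proj G) T \<and>
       (\<forall>H :: nat pair_pre_digraph.
          subgraph (with_proj H) (with_proj G) \<and>
          vertex_cut_sparsifier (with_proj G) T (with_proj H) \<longrightarrow>
            real (card (pverts H)) \<ge> c0 * (real k)\<^sup>2))"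
proof (intro exI[of _ "1/2 :: real"] conjI allI)
  fix k :: nat
  show "\<exists>(G :: nat pair_pre_digraph) (T :: nat set).
       pair_graph G \<and> T \<subseteq> pverts G \<and> card T = k \<and> quasi_bipartite (with_proj G) T \<and>
       (\<forall>H :: nat pair_pre_digraph.
          subgraph (with_proj H) (with_proj G) \<and>
          vertex_cut_sparsifier (with_proj G) T (with_proj H) \<longrightarrow>
            real (card (pverts H)) \<ge> 1/2 * (real k)\<^sup>2)"
    using pair_graph_subdivided_complete quasi_bipartite_subdivided_complete sparsifier_card_ge
      terminals_subset_subdivided_complete
    by (intro exI[of _ "subdivided_complete k"] exI[of _ "{..<k}"]) simp
qed simp

end
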